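(* Let $t$ be a $\lambda_s$-term and $A$ a type. If $\Gamma\vdash_{\lambda_s}t:A$, then $\Gamma\vdash_c\phi(t):A$.
   Context: **Types.** There are two sets of base types $\mathcal{A} = \{a,b,\dots\}$ and $\mathcal{A}^{\perp} = \{a^{\perp},b^{\perp},\dots\}$. The $m$-types are generated by $A ::= a \mid a^{\perp} \mid A\wedge A \mid A\vee A$ ($a\in\mathcal{A}$). A type is either an $m$-type or the constant $\perp$. Negation of $m$-types: $(a)^{\perp}=a^{\perp}$, $(a^{\perp})^{\perp}=a$, $(A\wedge B)^{\perp}=A^{\perp}\vee B^{\perp}$, $(A\vee B)^{\perp}=A^{\perp}\wedge B^{\perp}$. Below $\Gamma$ is a set of declarations assigning $m$-types to variables and, in the rules, $A,B,C$ range over $m$-types. **System $\lambda^{Sym}_{Prop}$.** The $\lambda_s$-terms are the expressions (up to renaming of bound variables) typable by: - $\Gamma, x:A\vdash x:A$; - from $\Gamma\vdash u:A$ and $\Gamma\vdash v:B$ infer $\Gamma\vdash \langle u,v\rangle : A\wedge B$; - from $\Gamma\vdash t:A$ infer $\Gamma\vdash\sigma_1(t):A\vee B$; - from $\Gamma\vdash t:B$ infer $\Gamma\vdash\sigma_2(t):A\vee B$; - from $\Gamma,x:A\vdash t:\perp$ infer $\Gamma\vdash\lambda x.t:A^{\perp}$; - from $\Gamma\vdash u:A^{\perp}$ and $\Gamma\vdash v:A$ infer $\Gamma\vdash u\star v:\perp$. Write $\Gamma\vdash_{\lambda_s}t:A$ for derivability. **System CCL.** The $c$-terms are the expressions built from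 variables and the constants $\mathbf{K},\mathbf{S},\mathbf{C},\mathbf{P},\mathbf{Q_1},\mathbf{Q_2}$ that are typable by: - $\Gamma,x:A\vdash x:A$; - $\Gamma\vdash\mathbf{K}:A^{\perp}\vee(B\vee A)$; - $\Gamma\vdash\mathbf{S}:(A\wedge(B\wedge C^{\perp}))\vee((A\wedge B^{\perp})\vee(A^{\perp}\vee C))$; - $\Gamma\vdash\mathbf{C}:(A\wedge B)\vee((A\wedge B^{\perp})\vee A^{\perp})$; - $\Gamma\vdash\mathbf{P}:A^{\perp}\vee(B^{\perp}\vee(A\wedge B))$; - $\Gamma\vdash\mathbf{Q_1}:A^{\perp}\vee(A\vee B)$; - $\Gamma\vdash\mathbf{Q_2}:B^{\perp}\vee(A\vee B)$; - from $\Gamma\vdash U:A^{\perp}\vee B$ and $\Gamma\vdash V:A$ infer $\Gamma\vdash(U\;V):B$; - from $\Gamma\vdash U:A^{\perp}$ and $\Gamma\vdash V:A$ infer $\Gamma\vdash U\star V:\perp$. Each axiom holds for all instances of $A,B,C$. Write $\Gamma\vdash_c U:A$ for derivability. $(U\;U_1\dots U_n)$ means $(\dots((U\;U_1)\;U_2)\dots U_n)$, and $\mathbf{I}=(\mathbf{S}\;\mathbf{K}\;\mathbf{K})$. $Var(T)$ is the set of variables of $T$. A pre-term is a $c$-term not containing $\star$. **Encoding $\phi$ of $\lambda_s$-terms into $c$-terms.** $\phi(x)=x$; $\phi(\lambda x.t)=l_x(\phi(t))$; $\phi(u\star v)=\phi(u)\star\phi(v)$; $\phi(\langle u,v\rangle)=(\mathbf{P}\;\phi(u)\;\phi(v))$;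 $\phi(\sigma_1(t))=(\mathbf{Q_1}\;\phi(t))$; $\phi(\sigma_2(t))=(\mathbf{Q_2}\;\phi(t))$, where - $l_x(x)=\mathbf{I}$; - $l_x(T)=(\mathbf{K}\;T)$ if $T$ is a pre-term and $x\notin Var(T)$; - $l_x((U\;V))=(\mathbf{S}\;l_x(U)\;l_x(V))$ if $x\in Var((U\;V))$; - $l_x(U\star V)=(\mathbf{C}\;l_x(U)\;l_x(V))$. *)

theory Defs
  imports Main
begin

section \<open>Types\<close>

datatype 'a mtype =
    Atom 'a
  | NegAtom 'a
  | Conj "'a mtype" "'a mtype"  (infixr \<open>\<^bold>\<and>\<close> 67)
  | Disj "'a mtype" "'a mtype"  (infixr \<open>\<^bold>\<or>\<close> 66)

datatype 'a ty = MType "'a mtype" | Bot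

primrec neg :: "'a mtype \<Rightarrow> 'a mtype" where
  "neg (Atom a) = NegAtom a"
| "neg (NegAtom a) = Atom a"
| "neg (A \<^bold>\<and> B) = neg A \<^bold>\<or> neg B"
| "neg (A \<^bold>\<or> B) = neg A \<^bold>\<and> neg B"

type_synonym var = nat

text \<open>A context declares at most one type for each variable; \<open>\<Gamma>, x : A\<close> is \<open>\<Gamma>(x \<mapsto> A)\<close>.\<close>

type_synonym 'a ctxt = "var \<rightharpoonup> 'a mtype"


section \<open>Lambda terms up to renaming of bound variables\<close>

datatype (raw_vars: 'v) raw =
    RVar 'v
  | RPair "'v raw" "'v raw"
  | RInj1 "'v raw"
  | RInj2 "'v raw"
  | RLam 'v "'v raw"
  | RStar "'v raw" "'v raw"

text \<open>
  Alpha-equivalence is the congruence generated by renaming a bound \<open>x\<close> to a \<open>y\<close> that does not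
  occur at all in the body. For such \<open>y\<close>, replacing every occurrence of \<open>x\<close>, inner binders of \<open>x\<close>
  included, cannot capture a variable.
\<close>

inductive alpha :: "'v raw \<Rightarrow> 'v raw \<Rightarrow> bool" where
  alpha_refl: "alpha t t"
| alpha_sym: "alpha t s \<Longrightarrow> alpha s t"
| alpha_trans: "alpha t s \<Longrightarrow> alpha s r \<Longrightarrow> alpha t r"
| alpha_pair: "alpha u u' \<Longrightarrow> alpha v v' \<Longrightarrow> alpha (RPair u v) (RPair u' v')"
| alpha_inj1: "alpha t t' \<Longrightarrow> alpha (RInj1 t) (RInj1 t')"
| alpha_inj2: "alpha t t' \<Longrightarrow> alpha (RInj2 t) (RInj2 t')"
| alpha_lam: "alpha t t' \<Longrightarrow> alpha (RLam x t) (RLam x t')"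
| alpha_star: "alpha u u' \<Longrightarrow> alpha v v' \<Longrightarrow> alpha (RStar u v) (RStar u' v')"
| alpha_rename: "y \<notin> raw_vars t \<Longrightarrow> alpha (RLam x t) (RLam y (map_raw (id(x := y)) t))"

lemma equivp_alpha: "equivp alpha"
  by (intro equivpI reflpI sympI transpI) (blast intro: alpha.intros)+

quotient_type lterm = "var raw" / alpha
  by (rule equivp_alpha)

lift_definition LVar :: "var \<Rightarrow> lterm" is RVar .

lift_definition LPair :: "lterm \<Rightarrow> lterm \<Rightarrow> lterm" is RPair
  by (rule alpha_pair)

lift_definition LInj1 :: "lterm \<Rightarrow> lterm" is RInj1
  by (rule alpha_inj1)

lift_definition LInj2 :: "lterm \<Rightarrow> lterm" is RInj2
  by (rule alpha_inj2)

lift_definition LLam :: "var \<Rightarrow> lterm \<Rightarrow> lterm" is RLam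
  by (rule alpha_lam)

lift_definition LStar :: "lterm \<Rightarrow> lterm \<Rightarrow> lterm" is RStar
  by (rule alpha_star)

inductive lam_typing :: "'a ctxt \<Rightarrow> lterm \<Rightarrow> 'a ty \<Rightarrow> bool"
    (\<open>_ \<turnstile>\<^sub>\<lambda> _ \<^bold>: _\<close> [50, 50, 50] 50) where
  lam_var: "\<Gamma> x = Some A \<Longrightarrow> \<Gamma> \<turnstile>\<^sub>\<lambda> LVar x \<^bold>: MType A"
| lam_pair: "\<Gamma> \<turnstile>\<^sub>\<lambda> u \<^bold>: MType A \<Longrightarrow> \<Gamma> \<turnstile>\<^sub>\<lambda> v \<^bold>: MType B \<Longrightarrow>
    \<Gamma> \<turnstile>\<^sub>\<lambda> LPair u v \<^bold>: MType (A \<^bold>\<and> B)"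
| lam_inj1: "\<Gamma> \<turnstile>\<^sub>\<lambda> t \<^bold>: MType A \<Longrightarrow> \<Gamma> \<turnstile>\<^sub>\<lambda> LInj1 t \<^bold>: MType (A \<^bold>\<or> B)"
| lam_inj2: "\<Gamma> \<turnstile>\<^sub>\<lambda> t \<^bold>: MType B \<Longrightarrow> \<Gamma> \<turnstile>\<^sub>\<lambda> LInj2 t \<^bold>: MType (A \<^bold>\<or> B)"
| lam_lam: "\<Gamma>(x \<mapsto> A) \<turnstile>\<^sub>\<lambda> t \<^bold>: Bot \<Longrightarrow> \<Gamma> \<turnstile>\<^sub>\<lambda> LLam x t \<^bold>: MType (neg A)"
| lam_star: "\<Gamma> \<turnstile>\<^sub>\<lambda> u \<^bold>: MType (neg A) \<Longrightarrow> \<Gamma> \<turnstile>\<^sub>\<lambda> v \<^bold>: MType A \<Longrightarrow>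
    \<Gamma> \<turnstile>\<^sub>\<lambda> LStar u v \<^bold>: Bot"


section \<open>Combinators\<close>

datatype (cvars: 'v) cterm =
    CVar 'v
  | CK | CS | CC | CP | CQ1 | CQ2
  | CApp "'v cterm" "'v cterm"  (infixl \<open>\<^bold>\<cdot>\<close> 75)
  | CStar "'v cterm" "'v cterm"  (infix \<open>\<^bold>\<star>\<close> 70)

inductive c_typing :: "'a ctxt \<Rightarrow> var cterm \<Rightarrow> 'a ty \<Rightarrow> bool"
    (\<open>_ \<turnstile>\<^sub>c _ \<^bold>: _\<close> [50, 50, 50] 50) where
  c_var: "\<Gamma> x = Some A \<Longrightarrow> \<Gamma> \<turnstile>\<^sub>c CVar x \<^bold>: MType A"
| c_K: "\<Gamma> \<turnstile>\<^sub>c CK \<^bold>: MType (neg A \<^bold>\<or> (B \<^bold>\<or> A))"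
| c_S: "\<Gamma> \<turnstile>\<^sub>c CS \<^bold>: MType ((A \<^bold>\<and> (B \<^bold>\<and> neg C)) \<^bold>\<or> ((A \<^bold>\<and> neg B) \<^bold>\<or> (neg A \<^bold>\<or> C)))"
| c_C: "\<Gamma> \<turnstile>\<^sub>c CC \<^bold>: MType ((A \<^bold>\<and> B) \<^bold>\<or> ((A \<^bold>\<and> neg B) \<^bold>\<or> neg A))"
| c_P: "\<Gamma> \<turnstile>\<^sub>c CP \<^bold>: MType (neg A \<^bold>\<or> (neg B \<^bold>\<or> (A \<^bold>\<and> B)))"
| c_Q1: "\<Gamma> \<turnstile>\<^sub>c CQ1 \<^bold>: MType (neg A \<^bold>\<or> (A \<^bold>\<or> B))"
| c_Q2: "\<Gamma> \<turnstile>\<^sub>c CQ2 \<^bold>: MType (neg B \<^bold>\<or> (A \<^bold>\<or> B))"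
| c_app: "\<Gamma> \<turnstile>\<^sub>c U \<^bold>: MType (neg A \<^bold>\<or> B) \<Longrightarrow> \<Gamma> \<turnstile>\<^sub>c V \<^bold>: MType A \<Longrightarrow>
    \<Gamma> \<turnstile>\<^sub>c U \<^bold>\<cdot> V \<^bold>: MType B"
| c_star: "\<Gamma> \<turnstile>\<^sub>c U \<^bold>: MType (neg A) \<Longrightarrow> \<Gamma> \<turnstile>\<^sub>c V \<^bold>: MType A \<Longrightarrow>
    \<Gamma> \<turnstile>\<^sub>c U \<^bold>\<star> V \<^bold>: Bot"

primrec star_free :: "'v cterm \<Rightarrow> bool" where
  "star_free (CVar x) \<longleftrightarrow> True"
| "star_free CK \<longleftrightarrow> True"
| "star_free CS \<longleftrightarrow> True"
| "star_free CC \<longleftrightarrow> True"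
| "star_free CP \<longleftrightarrow> True"
| "star_free CQ1 \<longleftrightarrow> True"
| "star_free CQ2 \<longleftrightarrow> True"
| "star_free (U \<^bold>\<cdot> V) \<longleftrightarrow> star_free U \<and> star_free V"
| "star_free (U \<^bold>\<star> V) \<longleftrightarrow> False"

definition CI :: "'v cterm" where
  "CI = CS \<^bold>\<cdot> CK \<^bold>\<cdot> CK"


section \<open>The encoding\<close>

text \<open>
  Abstraction is a total function on expressions. On a typable expression it is the usual partial
  definition: there the arguments of every application are star-free, so the \<open>else\<close> branch for
  \<open>U \<^bold>\<cdot> V\<close> is taken exactly when \<open>x\<close> occurs in \<open>U \<^bold>\<cdot> V\<close>.
\<close>

primrec l_abs :: "'v \<Rightarrow> 'v cterm \<Rightarrow> 'v cterm" where
  "l_abs x (CVar y) = (if y = x then CI else CK \<^bold>\<cdot> CVar y)"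
| "l_abs x CK = CK \<^bold>\<cdot> CK"
| "l_abs x CS = CK \<^bold>\<cdot> CS"
| "l_abs x CC = CK \<^bold>\<cdot> CC"
| "l_abs x CP = CK \<^bold>\<cdot> CP"
| "l_abs x CQ1 = CK \<^bold>\<cdot> CQ1"
| "l_abs x CQ2 = CK \<^bold>\<cdot> CQ2"
| "l_abs x (U \<^bold>\<cdot> V) =
    (if star_free (U \<^bold>\<cdot> V) \<and> x \<notin> cvars (U \<^bold>\<cdot> V) then CK \<^bold>\<cdot> (U \<^bold>\<cdot> V)
     else CS \<^bold>\<cdot> l_abs x U \<^bold>\<cdot> l_abs x V)"
| "l_abs x (U \<^bold>\<star> V) = CC \<^bold>\<cdot> l_abs x U \<^bold>\<cdot> l_abs x V"

primrec raw_phi :: "'v raw \<Rightarrow> 'v cterm" where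
  "raw_phi (RVar x) = CVar x"
| "raw_phi (RPair u v) = CP \<^bold>\<cdot> raw_phi u \<^bold>\<cdot> raw_phi v"
| "raw_phi (RInj1 t) = CQ1 \<^bold>\<cdot> raw_phi t"
| "raw_phi (RInj2 t) = CQ2 \<^bold>\<cdot> raw_phi t"
| "raw_phi (RLam x t) = l_abs x (raw_phi t)"
| "raw_phi (RStar u v) = raw_phi u \<^bold>\<star> raw_phi v"

lemma c_typing_star_free: "\<Gamma> \<turnstile>\<^sub>c U \<^bold>: MType A \<Longrightarrow> star_free U"
  by (induction U arbitrary: A) (auto elim: c_typing.cases)

lemma l_abs_equations:
  "l_abs x (CVar x) = CI"
  "star_free T \<Longrightarrow> x \<notin> cvars T \<Longrightarrow> l_abs x T = CK \<^bold>\<cdot> T"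
  "x \<in> cvars (U \<^bold>\<cdot> V) \<Longrightarrow> l_abs x (U \<^bold>\<cdot> V) = CS \<^bold>\<cdot> l_abs x U \<^bold>\<cdot> l_abs x V"
  "l_abs x (U \<^bold>\<star> V) = CC \<^bold>\<cdot> l_abs x U \<^bold>\<cdot> l_abs x V"
  by (simp, cases T, auto)

lemma star_free_map [simp]: "star_free (map_cterm f T) = star_free T"
  by (induction T) auto

lemma cvars_l_abs: "cvars (l_abs x T) = cvars T - {x}"
  by (induction T) (auto simp: CI_def)

lemma map_l_abs:
  assumes "inj_on f (insert x (cvars T))"
  shows "map_cterm f (l_abs x T) = l_abs (f x) (map_cterm f T)"
  using assms
proof (induction T)
  case (CApp U V)
  have "inj_on f (insert x (cvars U))" "inj_on f (insert x (cvars V))"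
    using CApp.prems by (auto intro: inj_on_subset)
  moreover have "f x \<in> f ` cvars (U \<^bold>\<cdot> V) \<longleftrightarrow> x \<in> cvars (U \<^bold>\<cdot> V)"
    using CApp.prems by (auto simp: inj_on_def)
  ultimately show ?case
    using CApp.IH by (auto simp: cterm.set_map)
next
  case (CStar U V)
  have "inj_on f (insert x (cvars U))" "inj_on f (insert x (cvars V))"
    using CStar.prems by (auto intro: inj_on_subset)
  then show ?case
    using CStar.IH by simp
qed (auto simp: CI_def inj_on_def)

lemma cvars_raw_phi: "cvars (raw_phi t) \<subseteq> raw_vars t"
  by (induction t) (auto simp: cvars_l_abs)

lemma map_raw_phi:
  assumes "inj_on f (raw_vars t)"
  shows "map_cterm f (raw_phi t) = raw_phi (map_raw f t)"
  using assms
proof (induction t)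
  case (RPair u v)
  then show ?case by (auto simp: inj_on_Un)
next
  case (RLam x t)
  have "inj_on f (insert x (cvars (raw_phi t)))"
    using RLam.prems cvars_raw_phi[of t] by (auto intro: inj_on_subset)
  then show ?case
    using RLam by (simp add: map_l_abs)
next
  case (RStar u v)
  then show ?case by (auto simp: inj_on_Un)
qed auto

lemma raw_phi_rename:
  assumes "y \<notin> raw_vars t"
  shows "raw_phi (RLam x t) = raw_phi (RLam y (map_raw (id(x := y)) t))"
proof -
  let ?f = "id(x := y)"
  have inj: "inj_on ?f (insert x (raw_vars t))"
    using assms by (auto simp: inj_on_def)
  then have "inj_on ?f (insert x (cvars (raw_phi t)))"
    using cvars_raw_phi[of t] by (auto intro: inj_on_subset)
  then have "map_cterm ?f (l_abs x (raw_phi t)) = l_abs y (map_cterm ?f (raw_phi t))"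
    by (simp add: map_l_abs)
  moreover have "map_cterm ?f (l_abs x (raw_phi t)) = map_cterm id (l_abs x (raw_phi t))"
    by (intro cterm.map_cong refl) (auto simp: cvars_l_abs)
  ultimately show ?thesis
    using map_raw_phi[of ?f t] inj by (simp add: cterm.map_id)
qed

lemma raw_phi_alpha: "alpha t s \<Longrightarrow> raw_phi t = raw_phi s"
proof (induction rule: alpha.induct)
  case (alpha_rename y t x)
  then show ?case by (rule raw_phi_rename)
qed auto

lift_definition phi :: "lterm \<Rightarrow> var cterm" is raw_phi
  by (rule raw_phi_alpha)

lemma phi_simps [simp]:
  "phi (LVar x) = CVar x"
  "phi (LPair u v) = CP \<^bold>\<cdot> phi u \<^bold>\<cdot> phi v"
  "phi (LInj1 t) = CQ1 \<^bold>\<cdot> phi t"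
  "phi (LInj2 t) = CQ2 \<^bold>\<cdot> phi t"
  "phi (LLam x t) = l_abs x (phi t)"
  "phi (LStar u v) = phi u \<^bold>\<star> phi v"
  by (transfer, simp)+

end

theory Submission
  imports Defs
begin

text \<open>
  The encoding turns each typing rule of the calculus into a rule derivable for combinators. Pairs
  and injections are immediate from the types of \<^term>\<open>CP\<close>, \<^term>\<open>CQ1\<close> and \<^term>\<open>CQ2\<close>; the content
  lies in \<open>\<lambda>\<close>-abstraction, that is, in a deduction theorem for combinators. As in the classical
  bracket abstraction, one reads \<^term>\<open>neg A \<^bold>\<or> B\<close> as the implication from \<open>A\<close> to \<open>B\<close>, so that
  \<^term>\<open>CK\<close> and \<^term>\<open>CS\<close> have their usual types once double negations are removed. Likewise
  \<^term>\<open>neg A\<close> plays the part of the implication from \<open>A\<close> to \<open>\<bottom>\<close>: since \<open>\<bottom>\<close> is not an \<open>m\<close>-type and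
  cannot occur inside a disjunction, \<^term>\<open>CC\<close> takes over for \<open>\<star>\<close> the task that \<^term>\<open>CS\<close> has for
  application.

  The deduction theorem \<open>c_typing_l_abs\<close> treats both kinds of result type uniformly by means of
  the type \<^term>\<open>imp A \<tau>\<close>. It follows by induction
  on the typing derivation, using derived typing rules for applied combinators and the fact that a
  declaration may be dropped when its variable does not occur (\<open>c_typing_cong\<close>). The theorem is then
  an induction on the derivation in the \<open>\<lambda>\<close>-calculus; renaming of bound variables does not matter,
  as the encoding is defined on equivalence classes and satisfies its recursion equations for every
  choice of the bound name.
\<close>

lemma neg_neg [simp]: "neg (neg A) = A"
  by (induction A) auto

text \<open>Both weakening and the removal of declarations for variables that do not occur.\<close>

lemma c_typing_cong:
  assumes "\<Gamma> \<turnstile>\<^sub>c T \<^bold>: \<tau>" and "\<And>y. y \<in> cvars T \<Longrightarrow> \<Gamma>' y = \<Gamma> y"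
  shows "\<Gamma>' \<turnstile>\<^sub>c T \<^bold>: \<tau>"
  using assms by (induction rule: c_typing.induct) (auto intro: c_typing.intros)

lemma c_typing_K_app:
  assumes "\<Gamma> \<turnstile>\<^sub>c T \<^bold>: MType B"
  shows "\<Gamma> \<turnstile>\<^sub>c CK \<^bold>\<cdot> T \<^bold>: MType (A \<^bold>\<or> B)"
  using c_K assms by (rule c_app)

lemma c_typing_S_app:
  assumes "\<Gamma> \<turnstile>\<^sub>c U \<^bold>: MType (neg A \<^bold>\<or> (neg B \<^bold>\<or> C))"
    and "\<Gamma> \<turnstile>\<^sub>c V \<^bold>: MType (neg A \<^bold>\<or> B)"
  shows "\<Gamma> \<turnstile>\<^sub>c CS \<^bold>\<cdot> U \<^bold>\<cdot> V \<^bold>: MType (neg A \<^bold>\<or> C)"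
proof (rule c_app[OF c_app[OF _ assms(1)] assms(2)])
  show "\<Gamma> \<turnstile>\<^sub>c CS \<^bold>: MType (neg (neg A \<^bold>\<or> (neg B \<^bold>\<or> C)) \<^bold>\<or> (neg (neg A \<^bold>\<or> B) \<^bold>\<or> (neg A \<^bold>\<or> C)))"
    using c_S[of \<Gamma> A B C] by simp
qed

lemma c_typing_C_app:
  assumes "\<Gamma> \<turnstile>\<^sub>c U \<^bold>: MType (neg A \<^bold>\<or> neg B)"
    and "\<Gamma> \<turnstile>\<^sub>c V \<^bold>: MType (neg A \<^bold>\<or> B)"
  shows "\<Gamma> \<turnstile>\<^sub>c CC \<^bold>\<cdot> U \<^bold>\<cdot> V \<^bold>: MType (neg A)"
proof (rule c_app[OF c_app[OF _ assms(1)] assms(2)])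
  show "\<Gamma> \<turnstile>\<^sub>c CC \<^bold>: MType (neg (neg A \<^bold>\<or> neg B) \<^bold>\<or> (neg (neg A \<^bold>\<or> B) \<^bold>\<or> neg A))"
    using c_C[of \<Gamma> A B] by simp
qed

lemma c_typing_I: "\<Gamma> \<turnstile>\<^sub>c CI \<^bold>: MType (neg A \<^bold>\<or> A)"
  unfolding CI_def
proof (rule c_typing_S_app)
  \<comment> \<open>The middle type must have the form of a result of the second \<^term>\<open>CK\<close>; its left disjunct is
    arbitrary, and \<open>A\<close> serves.\<close>
  show "\<Gamma> \<turnstile>\<^sub>c CK \<^bold>: MType (neg A \<^bold>\<or> (neg (A \<^bold>\<or> A) \<^bold>\<or> A))"
    by (rule c_K)
  show "\<Gamma> \<turnstile>\<^sub>c CK \<^bold>: MType (neg A \<^bold>\<or> (A \<^bold>\<or> A))"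
    by (rule c_K)
qed

text \<open>
  The implication into \<open>\<bottom>\<close> is the negation, as if \<open>\<bottom>\<close> were the unit of the disjunction.
\<close>

primrec imp :: "'a mtype \<Rightarrow> 'a ty \<Rightarrow> 'a mtype" where
  "imp A (MType B) = neg A \<^bold>\<or> B"
| "imp A Bot = neg A"

text \<open>
  The deduction theorem. Each clause of the abstraction is typed by the combinator it introduces:
  discarding the argument by \<^term>\<open>CK\<close>, passing it to both parts by \<^term>\<open>CS\<close> or \<^term>\<open>CC\<close>, and
  returning it by \<^term>\<open>CI\<close>.
\<close>

lemma c_typing_l_abs:
  assumes "\<Gamma>(x \<mapsto> A) \<turnstile>\<^sub>c T \<^bold>: \<tau>"
  shows "\<Gamma> \<turnstile>\<^sub>c l_abs x T \<^bold>: MType (imp A \<tau>)"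
  using assms
proof (induction "\<Gamma>(x \<mapsto> A)" T \<tau> rule: c_typing.induct)
  case (c_var y B)
  then show ?case
    by (auto split: if_splits intro: c_typing_I c_typing_K_app c_typing.c_var)
next
  case (c_app U B C V)
  show ?case
  proof (cases "star_free (U \<^bold>\<cdot> V) \<and> x \<notin> cvars (U \<^bold>\<cdot> V)")
    case True
    have "\<Gamma>(x \<mapsto> A) \<turnstile>\<^sub>c U \<^bold>\<cdot> V \<^bold>: MType C"
      using c_app by (blast intro: c_typing.c_app)
    then have "\<Gamma> \<turnstile>\<^sub>c U \<^bold>\<cdot> V \<^bold>: MType C"
      by (rule c_typing_cong) (use True in auto)
    then show ?thesis
      using True by (simp add: c_typing_K_app)
  next
    case False
    then have "l_abs x (U \<^bold>\<cdot> V) = CS \<^bold>\<cdot> l_abs x U \<^bold>\<cdot> l_abs x V"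
      by (simp only: l_abs.simps if_False)
    then show ?thesis
      using c_app by (auto intro: c_typing_S_app)
  qed
next
  case (c_star U B V)
  then show ?case
    by (auto intro: c_typing_C_app)
qed (auto intro!: c_typing_K_app intro: c_typing.intros)

theorem theorem16:
  fixes \<Gamma> :: "'a ctxt" and t :: lterm and A :: "'a ty"
  assumes "\<Gamma> \<turnstile>\<^sub>\<lambda> t \<^bold>: A"
  shows "\<Gamma> \<turnstile>\<^sub>c phi t \<^bold>: A"
  using assms
proof (induction rule: lam_typing.induct)
  case (lam_lam \<Gamma> x A t)
  from c_typing_l_abs[OF lam_lam.IH] show ?case
    by simp
qed (auto intro: c_typing.intros)

end
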